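(* Let $\hat N\ge1$, $\hat{\mathcal N}=\{1,\dots,\hat N\}$, let $J,K$ be positive integers, and fix arbitrary real parameters $(\mathbf w,\mathbf b)$ for each of the two monotonic networks $\nu^x_{\mathbf{w,b}},\nu^y_{\mathbf{w,b}}$ defined in the context. Then the MDL mechanism $$\mathsf{M}_{\mathrm{MDL}}(\mathbf L)=\Bigl(\max_{i\in\hat{\mathcal N}}\min\{\nu^{x}_{\mathbf{w,b}}(\mu(\mathcal T_x(i))),\,x_{\pi_x(i)}\},\ \max_{j\in\hat{\mathcal N}}\min\{\nu^{y}_{\mathbf{w,b}}(\mu(\mathcal T_y(j))),\,y_{\pi_y(j)}\}\Bigr)$$ is strategyproof: for every worker $i\in\hat{\mathcal N}$, every true location $L_i\in\mathbb R^2$, every vector $\mathbf L_{-i}$ of the other workers' reported locations in $\mathbb R^2$, and every misreport $L_i'\ne L_i$ in $\mathbb R^2$, $$\hat u_i(\mathsf{M}_{\mathrm{MDL}}(L_i,\mathbf L_{-i}))\ \ge\ \hat u_i(\mathsf{M}_{\mathrm{MDL}}(L_i',\mathbf L_{-i})),$$ where $\hat u_i$ is worker $i$'s utility evaluated with its true location $L_i$.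
   Context: Utilities. There are $\hat N$ workers; worker $i$ has true location $L_i=(x_i,y_i)$ and fixed rate $\tilde r_i>0$. For a base station location $L_{\mathrm M}=(x_{\mathrm M},y_{\mathrm M})$, $$\hat u_i(L_{\mathrm M})=\frac{\tilde r_i}{\sum_{j\in\hat{\mathcal N}}\tilde r_j}\tilde P_c-\frac{2^{\tilde r_i/B}-1}{g}\Bigl((x_i-x_{\mathrm M})^2+(y_i-y_{\mathrm M})^2+h^2\Bigr)^{\alpha/2}-b_i\tilde r_i,$$ with constants $\tilde P_c,B,g,h,b_i>0$ and $\alpha\ge2$ (rates and constants do not depend on the reported locations). Mechanism. Given reported locations $\mathbf L=((x_1,y_1),\dots,(x_{\hat N},y_{\hat N}))$, let $\pi_x,\pi_y$ be permutations of $\hat{\mathcal N}$ sorting coordinates in ascending order, $x_{\pi_x(1)}\le\dots\le x_{\pi_x(\hat N)}$ and $y_{\pi_y(1)}\le\dots\le y_{\pi_y(\hat N)}$ (ties broken by any fixed rule), and set $\mathcal T_x(j)=\{\pi_x(1),\dots,\pi_x(j)\}$, $\mathcal T_y(j)=\{\pi_y(1),\dots,\pi_y(j)\}$. For $\mathcal T\subseteq\hat{\mathcal N}$, $\mu(\mathcal T)=\mathbf z=(z_1,\dots,z_{\hat N})$ with $z_i=1$ if $i\in\mathcal T$ and $z_i=-1$ if $i\notin\mathcal T$. A monotonic network is the function $$\nu_{\mathbf{w,b}}(\mathbf z)=\max_{1\le j\le J}\ \min_{1\le k\le K}\ s\bigl(b_{jk2}+\mathrm e^{\mathbf w_{jk2}}\,s(\mathrm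 e^{\mathbf w_{j1}}\mathbf z^{\mathrm T}+\mathbf b_{j1})\bigr),$$ where $\mathbf w_{j1}\in\mathbb R^{K\times\hat N}$, $\mathbf b_{j1}\in\mathbb R^{K\times1}$, $\mathbf w_{jk2}\in\mathbb R^{1\times K}$, $b_{jk2}\in\mathbb R$, the exponential of a matrix or vector is taken entrywise, and $s(t)=\log\frac{1}{1+\mathrm e^{-t}}+1$ is applied entrywise. $\nu^x_{\mathbf{w,b}}$ and $\nu^y_{\mathbf{w,b}}$ are two such networks, each with its own parameters. *)

theory Defs
  imports Complex_Main "HOL-Combinatorics.Permutations"
begin

type_synonym location = "real \<times> real"

text \<open>Vectors and matrices are functions on positive naturals. A profile over the workers
  \<open>{1..N}\<close> has type \<open>nat \<Rightarrow> location\<close>; entries at indices outside the stated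
  ranges carry no meaning.\<close>

subsection \<open>Utilities\<close>

definition utility ::
  "nat \<Rightarrow> (nat \<Rightarrow> real) \<Rightarrow> real \<Rightarrow> real \<Rightarrow> real \<Rightarrow> real \<Rightarrow> real \<Rightarrow> (nat \<Rightarrow> real)
    \<Rightarrow> nat \<Rightarrow> location \<Rightarrow> location \<Rightarrow> real"
where
  "utility N r P B g h \<alpha> b i L\<^sub>i L\<^sub>M =
     r i / (\<Sum>j = 1..N. r j) * P
     - (2 powr (r i / B) - 1) / g
         * ((fst L\<^sub>i - fst L\<^sub>M)\<^sup>2 + (snd L\<^sub>i - snd L\<^sub>M)\<^sup>2 + h\<^sup>2) powr (\<alpha> / 2)
     - b i * r i"

subsection \<open>Monotonic networks\<close>

text \<open>\<open>W1 j\<close> is the \<open>K \<times> N\<close> matrix and \<open>b1 j\<close> the \<open>K\<close>-vector of the inner layer;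
  \<open>w2 j k\<close> is the \<open>K\<close>-vector and \<open>b2 j k\<close> the scalar of the outer layer.\<close>

record network =
  W1 :: "nat \<Rightarrow> nat \<Rightarrow> nat \<Rightarrow> real"
  b1 :: "nat \<Rightarrow> nat \<Rightarrow> real"
  w2 :: "nat \<Rightarrow> nat \<Rightarrow> nat \<Rightarrow> real"
  b2 :: "nat \<Rightarrow> nat \<Rightarrow> real"

definition activation :: "real \<Rightarrow> real" where
  "activation t = ln (1 / (1 + exp (- t))) + 1"

definition monotonic_network :: "nat \<Rightarrow> nat \<Rightarrow> nat \<Rightarrow> network \<Rightarrow> (nat \<Rightarrow> real) \<Rightarrow> real" where
  "monotonic_network N J K p z =
     (MAX j\<in>{1..J}. MIN k\<in>{1..K}.
        activation (b2 p j k + (\<Sum>l = 1..K. exp (w2 p j k l) *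
          activation ((\<Sum>i = 1..N. exp (W1 p j l i) * z i) + b1 p j l))))"

subsection \<open>The mechanism\<close>

text \<open>\<open>\<pi> L\<close> is a permutation sorting the workers by the coordinate \<open>c\<close> of their locations
  reported in \<open>L\<close>; how \<open>\<pi>\<close> breaks ties is left open and may depend on the whole profile.\<close>

definition sorting_rule ::
  "nat \<Rightarrow> (location \<Rightarrow> real) \<Rightarrow> ((nat \<Rightarrow> location) \<Rightarrow> nat \<Rightarrow> nat) \<Rightarrow> bool"
where
  "sorting_rule N c \<pi> \<longleftrightarrow>
     (\<forall>L. \<pi> L permutes {1..N} \<and> mono_on {1..N} (\<lambda>j. c (L (\<pi> L j))))"

definition initial_workers :: "(nat \<Rightarrow> nat) \<Rightarrow> nat \<Rightarrow> nat set" where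
  "initial_workers \<sigma> j = \<sigma> ` {1..j}"

definition sign_vector :: "nat set \<Rightarrow> nat \<Rightarrow> real" where
  "sign_vector T i = (if i \<in> T then 1 else - 1)"

definition coordinate_outcome ::
  "nat \<Rightarrow> ((nat \<Rightarrow> real) \<Rightarrow> real) \<Rightarrow> (nat \<Rightarrow> nat) \<Rightarrow> (nat \<Rightarrow> real) \<Rightarrow> real"
where
  "coordinate_outcome N \<nu> \<sigma> x =
     (MAX i\<in>{1..N}. min (\<nu> (sign_vector (initial_workers \<sigma> i))) (x (\<sigma> i)))"

definition MDL_mechanism ::
  "nat \<Rightarrow> nat \<Rightarrow> nat \<Rightarrow> network \<Rightarrow> network
    \<Rightarrow> ((nat \<Rightarrow> location) \<Rightarrow> nat \<Rightarrow> nat) \<Rightarrow> ((nat \<Rightarrow> location) \<Rightarrow> nat \<Rightarrow> nat)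
    \<Rightarrow> (nat \<Rightarrow> location) \<Rightarrow> location"
where
  "MDL_mechanism N J K p q \<pi>\<^sub>x \<pi>\<^sub>y L =
     (coordinate_outcome N (monotonic_network N J K p) (\<pi>\<^sub>x L) (\<lambda>i. fst (L i)),
      coordinate_outcome N (monotonic_network N J K q) (\<pi>\<^sub>y L) (\<lambda>i. snd (L i)))"

subsection \<open>Strategyproofness\<close>

text \<open>\<open>u i L\<^sub>i L\<^sub>M\<close> is the utility of worker \<open>i\<close> with true location \<open>L\<^sub>i\<close> when the base station
  is at \<open>L\<^sub>M\<close>. Only the entries of \<open>L\<close> other than \<open>L i\<close> matter below.\<close>

definition strategyproof ::
  "nat \<Rightarrow> (nat \<Rightarrow> location \<Rightarrow> location \<Rightarrow> real) \<Rightarrow> ((nat \<Rightarrow> location) \<Rightarrow> location) \<Rightarrow> bool"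
where
  "strategyproof N u M \<longleftrightarrow>
     (\<forall>i\<in>{1..N}. \<forall>L\<^sub>i L L\<^sub>i'. L\<^sub>i' \<noteq> L\<^sub>i \<longrightarrow>
        u i L\<^sub>i (M (L(i := L\<^sub>i))) \<ge> u i L\<^sub>i (M (L(i := L\<^sub>i'))))"

end

(* A monotone nu makes both nu (T i) and the i-th smallest coordinate nondecreasing in i, so the
   maximum over i is attained at i = N: each coordinate of the outcome is min c (max of the reports),
   where c = nu (mu {1..N}) is a constant.  This is a generalized median; a misreport can only move
   it away from the worker's true coordinate, and utility decreases in the distance. *)
theory Submission
  imports Defs
begin

lemma activation_mono:
  assumes "s \<le> t"
  shows "activation s \<le> activation t"
proof -
  have "1 / (1 + exp (- s)) \<le> 1 / (1 + exp (- t))"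
    using assms by (intro divide_left_mono) (auto simp: add_pos_pos)
  then show ?thesis
    unfolding activation_def by (simp add: add_pos_pos)
qed

lemma Max_image_mono:
  fixes f f' :: "'a \<Rightarrow> 'b::linorder"
  assumes "finite A" "A \<noteq> {}" "\<And>a. a \<in> A \<Longrightarrow> f a \<le> f' a"
  shows "Max (f ` A) \<le> Max (f' ` A)"
proof -
  have "f a \<le> Max (f' ` A)" if "a \<in> A" for a
    using assms(1) that by (intro order_trans[OF assms(3) Max_ge]) auto
  then show ?thesis
    using assms(1,2) by (intro Max.boundedI) auto
qed

lemma Min_image_mono:
  fixes f f' :: "'a \<Rightarrow> 'b::linorder"
  assumes "finite A" "A \<noteq> {}" "\<And>a. a \<in> A \<Longrightarrow> f a \<le> f' a"
  shows "Min (f ` A) \<le> Min (f' ` A)"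
proof -
  have "Min (f ` A) \<le> f' a" if "a \<in> A" for a
    using assms(1) that by (intro order_trans[OF Min_le assms(3)]) auto
  then show ?thesis
    using assms(1,2) by (intro Min.boundedI) auto
qed

text \<open>Exponentiated weights are positive, so both layers preserve the order of their inputs;
  the increasing activation and the outer min and max preserve it too.\<close>

lemma monotonic_network_mono:
  assumes "J \<ge> 1" "K \<ge> 1" "\<And>i. i \<in> {1..N} \<Longrightarrow> z i \<le> z' i"
  shows "monotonic_network N J K p z \<le> monotonic_network N J K p z'"
  unfolding monotonic_network_def using assms
  by (intro Max_image_mono Min_image_mono activation_mono add_left_mono add_right_mono sum_mono
      mult_left_mono) auto

text \<open>The right-hand side does not mention \<open>\<sigma>\<close>: the way ties are broken
  cannot affect the outcome.\<close>

lemma coordinate_outcome_eq_min_Max: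
  assumes "N \<ge> 1" "\<sigma> permutes {1..N}" "mono_on {1..N} (\<lambda>j. x (\<sigma> j))"
    and mono: "\<And>S T. S \<subseteq> T \<Longrightarrow> \<nu> (sign_vector S) \<le> \<nu> (sign_vector T)"
  shows "coordinate_outcome N \<nu> \<sigma> x = min (\<nu> (sign_vector {1..N})) (Max (x ` {1..N}))"
proof -
  let ?F = "\<lambda>i. min (\<nu> (sign_vector (initial_workers \<sigma> i))) (x (\<sigma> i))"
  have onto: "\<sigma> ` {1..N} = {1..N}"
    using assms(2) by (rule permutes_image)
  have x_le: "x (\<sigma> i) \<le> x (\<sigma> N)" if "i \<in> {1..N}" for i
    using assms(1,3) that by (auto simp: mono_on_def)
  have "Max (?F ` {1..N}) = ?F N"
  proof (intro Max_eqI)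
    fix y assume "y \<in> ?F ` {1..N}"
    then obtain i where i: "i \<in> {1..N}" "y = ?F i" by blast
    have "initial_workers \<sigma> i \<subseteq> initial_workers \<sigma> N"
      using i(1) by (auto simp: initial_workers_def)
    then show "y \<le> ?F N"
      unfolding i(2) by (intro min.mono mono x_le i(1))
  qed (use assms(1) in auto)
  moreover have "Max (x ` {1..N}) = x (\<sigma> N)"
  proof (intro Max_eqI)
    fix y assume "y \<in> x ` {1..N}"
    \<comment> \<open>Reindexing along \<open>\<sigma>\<close> writes every report as some
      \<open>x (\<sigma> i)\<close>, which \<open>x_le\<close> bounds.\<close>
    then have "y \<in> x ` \<sigma> ` {1..N}" by (simp only: onto)
    then show "y \<le> x (\<sigma> N)" using x_le by blast
  next
    have "\<sigma> N \<in> {1..N}" using onto assms(1) by fastforce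
    then show "x (\<sigma> N) \<in> x ` {1..N}" by blast
  qed simp
  \<comment> \<open>By \<open>onto\<close>, \<open>initial_workers \<sigma> N\<close> is all of
    \<open>{1..N}\<close>.\<close>
  ultimately show ?thesis
    unfolding coordinate_outcome_def initial_workers_def by (simp only: onto)
qed

text \<open>If \<open>c < a\<close>, truth gives \<open>c\<close> and no report gives more. If
  \<open>a \<le> c\<close>, either the truthful maximum is \<open>a\<close> and the outcome is
  exact, or another report exceeds \<open>a\<close> and already pushes the outcome beyond
  \<open>a\<close>; lying cannot lower it.\<close>

lemma min_Max_strategyproof:
  fixes c a a' :: real and x :: "'i \<Rightarrow> real"
  assumes "finite A" "i \<in> A"
  shows "\<bar>a - min c (Max ((x(i := a)) ` A))\<bar> \<le> \<bar>a - min c (Max ((x(i := a')) ` A))\<bar>"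
proof -
  let ?m = "Max ((x(i := a)) ` A)" and ?m' = "Max ((x(i := a')) ` A)"
  have "(x(i := a)) i \<le> ?m"
    using assms by (intro Max_ge) blast+
  \<comment> \<open>Split on who attains the truthful maximum: worker \<open>i\<close>, or some
    \<open>k\<close> whose entry survives the misreport.\<close>
  moreover have "?m = a \<or> ?m \<le> ?m'"
  proof -
    have "?m \<in> (x(i := a)) ` A"
      using assms by (intro Max_in) auto
    then obtain k where k: "k \<in> A" "?m = (x(i := a)) k" by blast
    have "(x(i := a')) k \<le> ?m'"
      using assms k(1) by (intro Max_ge) blast+
    then show ?thesis using k(2) by (cases "k = i") auto
  qed
  ultimately show ?thesis by (auto simp: min_def)
qed

lemma coordinate_outcome_strategyproof:
  fixes c :: "location \<Rightarrow> real" and p :: network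
  assumes "N \<ge> 1" "J \<ge> 1" "K \<ge> 1" "sorting_rule N c \<pi>" "i \<in> {1..N}"
  defines "out \<equiv> \<lambda>L. coordinate_outcome N (monotonic_network N J K p) (\<pi> L) (\<lambda>k. c (L k))"
  shows "\<bar>c L\<^sub>i - out (L(i := L\<^sub>i))\<bar> \<le> \<bar>c L\<^sub>i - out (L(i := L\<^sub>i'))\<bar>"
proof -
  have mono: "monotonic_network N J K p (sign_vector S) \<le> monotonic_network N J K p (sign_vector T)"
    if "S \<subseteq> T" for S T
    using that assms(2,3) by (intro monotonic_network_mono) (auto simp: sign_vector_def)
  \<comment> \<open>The first argument of \<open>min\<close> is the same for all \<open>M\<close>,
    even though the permutation \<open>\<pi> (L(i := M))\<close> may change with
    \<open>M\<close>.\<close>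
  have out: "out (L(i := M)) = min (monotonic_network N J K p (sign_vector {1..N}))
      (Max (((\<lambda>k. c (L k))(i := c M)) ` {1..N}))" for M
  proof -
    have "(\<lambda>k. c ((L(i := M)) k)) = (\<lambda>k. c (L k))(i := c M)" by auto
    moreover have "out (L(i := M)) = min (monotonic_network N J K p (sign_vector {1..N}))
        (Max ((\<lambda>k. c ((L(i := M)) k)) ` {1..N}))"
      unfolding out_def using assms(1,4) mono
      unfolding sorting_rule_def by (intro coordinate_outcome_eq_min_Max) blast+
    ultimately show ?thesis by (simp only:)
  qed
  show ?thesis
    unfolding out using assms(5) by (intro min_Max_strategyproof) auto
qed

text \<open>The base station location enters only through the power term, whose coefficient is
  nonnegative as \<open>2 powr (r i / B) \<ge> 1\<close>. The squared distance is a sum over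
  coordinates, so coordinatewise comparison suffices.\<close>

lemma utility_antimono_distance:
  assumes "r i \<ge> 0" "B > 0" "g > 0" "\<alpha> \<ge> 0"
    and "\<bar>fst L - fst M\<bar> \<le> \<bar>fst L - fst M'\<bar>" "\<bar>snd L - snd M\<bar> \<le> \<bar>snd L - snd M'\<bar>"
  shows "utility N r P B g h \<alpha> b i L M' \<le> utility N r P B g h \<alpha> b i L M"
proof -
  have "0 \<le> (2 powr (r i / B) - 1) / g"
    using assms by (simp add: ge_one_powr_ge_zero)
  moreover have "((fst L - fst M)\<^sup>2 + (snd L - snd M)\<^sup>2 + h\<^sup>2) powr (\<alpha> / 2)
      \<le> ((fst L - fst M')\<^sup>2 + (snd L - snd M')\<^sup>2 + h\<^sup>2) powr (\<alpha> / 2)"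
    using assms(4-6) by (intro powr_mono2 add_mono) (auto simp: abs_le_square_iff)
  ultimately show ?thesis
    unfolding utility_def by (intro diff_right_mono diff_left_mono mult_left_mono)
qed

theorem mainTheorem3:
  fixes N J K :: nat
    and p q :: network
    and \<pi>\<^sub>x \<pi>\<^sub>y :: "(nat \<Rightarrow> location) \<Rightarrow> nat \<Rightarrow> nat"
    and r b :: "nat \<Rightarrow> real"
    and P B g h \<alpha> :: real
  assumes "N \<ge> 1" "J \<ge> 1" "K \<ge> 1"
    and "\<forall>i\<in>{1..N}. r i > 0" "\<forall>i\<in>{1..N}. b i > 0"
    and "P > 0" "B > 0" "g > 0" "h > 0" "\<alpha> \<ge> 2"
    and "sorting_rule N fst \<pi>\<^sub>x" "sorting_rule N snd \<pi>\<^sub>y"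
  shows "strategyproof N (utility N r P B g h \<alpha> b) (MDL_mechanism N J K p q \<pi>\<^sub>x \<pi>\<^sub>y)"
  unfolding strategyproof_def
\<comment> \<open>This leaves one distance inequality per coordinate, each an instance of the
  one-dimensional result.\<close>
proof (intro ballI allI impI utility_antimono_distance)
  fix i L L\<^sub>i L\<^sub>i'
  assume i: "i \<in> {1..N}"
  let ?M = "\<lambda>K\<^sub>i. MDL_mechanism N J K p q \<pi>\<^sub>x \<pi>\<^sub>y (L(i := K\<^sub>i))"
  show "r i \<ge> 0" using assms(4) i by (simp add: less_imp_le)
  show "\<bar>fst L\<^sub>i - fst (?M L\<^sub>i)\<bar> \<le> \<bar>fst L\<^sub>i - fst (?M L\<^sub>i')\<bar>"
    unfolding MDL_mechanism_def fst_conv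
    by (intro coordinate_outcome_strategyproof assms i)
  show "\<bar>snd L\<^sub>i - snd (?M L\<^sub>i)\<bar> \<le> \<bar>snd L\<^sub>i - snd (?M L\<^sub>i')\<bar>"
    unfolding MDL_mechanism_def snd_conv
    by (intro coordinate_outcome_strategyproof assms i)
qed (use assms in auto)

end
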